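(* Let $\mathcal{M}_{\mathcal{L}}$ be the set of free channels of a quantum resource theory on a $d$-dimensional system, let $\mathcal{E}\notin\mathcal{M}_{\mathcal{L}}$ be a resourceful quantum channel on this system with Choi state $J_{AB}^{\mathcal{E}}$ and generalized channel robustness $\mathcal{R}_{\mathcal{M}_{\mathcal{L}}}(\mathcal{E})$, and let $Z^*$ be an optimal robustness witness for the channel $\mathcal{E}$. Let $\beta\in(0,\infty)$ be the inverse temperature of a thermal bath. Then for every real $\lambda>0$ with $\lambda\ge\beta^{-1}S(J_{AB}^{\mathcal{E}})/\mathcal{R}_{\mathcal{M}_{\mathcal{L}}}(\mathcal{E})$, $$\eta_{\mathrm{cost}}(\mathcal{E})\le\frac{1+\lambda^{-1}\beta^{-1}S\big(\tau^\beta_{\lambda Z^*}\big)}{1+\mathcal{R}_{\mathcal{M}_{\mathcal{L}}}(\mathcal{E})+\lambda^{-1}\beta^{-1}\Big(S\big(\tau^\beta_{\lambda Z^*}\big)-S\big(J_{AB}^{\mathcal{E}}\big)\Big)},$$ where $\tau^\beta_{\lambda Z^*}$ is the thermal state of the Hamiltonian $\lambda Z^*$ at inverse temperature $\beta$. Moreover, at zero temperature, $\eta_{\mathrm{cost}}(\mathcal{E})\le\dfrac{1}{1+\mathcal{R}_{\mathcal{M}_{\mathcal{L}}}(\mathcal{E})}$.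
   Context: A state is a positive semidefinite operator of unit trace; a quantum channel is a completely positive trace-preserving map, here from operators on a $d$-dimensional Hilbert space to operators on the same space. $\mathcal{L}$ is a nonempty, closed, convex set of states on this space, called free states, and $\mathcal{M}_{\mathcal{L}}$ is the set of resource non-increasing (free) channels $\Omega$, i.e. those that map free states to free states. Channels not in $\mathcal{M}_{\mathcal{L}}$ are called resourceful. Choi state: let $\mathcal{H}_A,\mathcal{H}_B$ have dimension $d$, let $|\Phi\rangle=\frac{1}{\sqrt d}\sum_{j=1}^d|j\rangle\otimes|j\rangle$, and let $J_{AB}^{\mathcal{E}}:=(\mathcal{E}\otimes\mathrm{id}_B)(|\Phi\rangle\langle\Phi|)$, a state on $\mathcal{H}_A\otimes\mathcal{H}_B$. Generalized channel robustness: $\mathcal{R}_{\mathcal{M}_{\mathcal{L}}}(\mathcal{E}):=\min\{s\ge0 : \text{there is a quantum channel }\kappa\text{ with }\frac{\mathcal{E}+s\kappa}{1+s}\in\mathcal{M}_{\mathcal{L}}\}$. It has the dual form $\mathcal{R}_{\mathcal{M}_{\mathcal{L}}}(\mathcal{E})=\max\{\mathrm{Tr}(ZJ_{AB}^{\mathcal{E}})-1 : Z\ge0,\ \mathrm{Tr}(ZJ_{AB}^{\Omega})\le1\ \forall\,\Omega\in\mathcal{M}_{\mathcal{L}}\}$, with $Z$ Hermitian on $\mathcal{H}_A\otimes\mathcal{H}_B$. An optimal robustness witness for $\mathcal{E}$ is an operator $Z^*\ge0$ with $\mathrm{Tr}(Z^*J_{AB}^{\Omega})\le1$ for all $\Omega\in\mathcal{M}_{\mathcal{L}}$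 and $\mathrm{Tr}(Z^*J_{AB}^{\mathcal{E}})-1=\mathcal{R}_{\mathcal{M}_{\mathcal{L}}}(\mathcal{E})$. For a Hamiltonian (Hermitian operator) $H$: $S(\rho)=-\mathrm{Tr}(\rho\log\rho)$ is the von Neumann entropy (natural logarithm), $F_H(\rho):=\mathrm{Tr}(H\rho)-\beta^{-1}S(\rho)$ is the free energy, $\tau_H^\beta:=e^{-\beta H}/\mathrm{Tr}(e^{-\beta H})$ is the thermal state. The work cost of implementing a channel $\mathcal{E}$ (via preparing its Choi state), for a Hamiltonian $H_{AB}$ on $\mathcal{H}_A\otimes\mathcal{H}_B$, is $W^{\mathrm{cost}}_{H_{AB}}(\mathcal{E}):=F_{H_{AB}}(J_{AB}^{\mathcal{E}})-F_{H_{AB}}(\tau^\beta_{H_{AB}})\ge0$. The relative cost is $$\eta_{\mathrm{cost}}(\mathcal{E}):=\min_{H_{AB}\ge0}\frac{\max_{\Omega\in\mathcal{M}_{\mathcal{L}}}W^{\mathrm{cost}}_{H_{AB}}(\Omega)}{W^{\mathrm{cost}}_{H_{AB}}(\mathcal{E})},$$ the minimum (an infimum if not attained) being over all positive semidefinite $H_{AB}$ on $\mathcal{H}_A\otimes\mathcal{H}_B$; Hamiltonians for which the denominator vanishes are excluded. Zero temperature means $\beta^{-1}=0$: the entropic terms vanish, so $F_H(\rho)=\mathrm{Tr}(H\rho)$ and $F_H(\tau_H^\beta)$ is replaced by the smallest eigenvalue of $H$, and $\eta_{\mathrm{cost}}$ is defined with these quantities. *)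

theory Defs
  imports "HOL-Analysis.Analysis"
begin

section \<open>Operators, states and channels\<close>

text \<open>
  Operators on a Hilbert space of dimension \<open>CARD('n)\<close> are complex matrices indexed by
  \<open>'n\<close>; the tensor product of the spaces indexed by \<open>'a\<close> and \<open>'b\<close> is indexed by \<open>'a \<times> 'b\<close>.
\<close>

type_synonym 'n op = "complex^'n^'n"

definition cdot :: "complex^'n::finite \<Rightarrow> complex^'n \<Rightarrow> complex" where
  "cdot v w = (\<Sum>i\<in>UNIV. cnj (v $ i) * w $ i)"

text \<open>Over the complex numbers, a nonnegative quadratic form already forces hermiticity.\<close>

definition psd :: "'n::finite op \<Rightarrow> bool" where
  "psd A \<longleftrightarrow> (\<forall>v. cdot v (A *v v) \<in> \<real>\<^sub>\<ge>\<^sub>0)"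

definition state :: "'n::finite op \<Rightarrow> bool" where
  "state \<rho> \<longleftrightarrow> psd \<rho> \<and> trace \<rho> = 1"

definition scale_op :: "complex \<Rightarrow> 'n::finite op \<Rightarrow> 'n op" where
  "scale_op c A = (\<chi> i j. c * A $ i $ j)"

text \<open>
  Positivity of \<open>\<E> \<otimes> id\<^sub>k\<close> for every ancilla dimension \<open>k\<close>. Since \<open>k\<close> is quantified inside the
  definition, an operator on the tensor product with the \<open>k\<close>-dimensional ancilla is given by its
  blocks \<open>X i j\<close> (\<open>i, j < k\<close>), a vector by its components \<open>v i\<close> (\<open>i < k\<close>), and \<open>\<E> \<otimes> id\<^sub>k\<close>
  acts blockwise.
\<close>

definition block_psd :: "nat \<Rightarrow> (nat \<Rightarrow> nat \<Rightarrow> 'n::finite op) \<Rightarrow> bool" where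
  "block_psd k X \<longleftrightarrow>
     (\<forall>v. (\<Sum>i<k. \<Sum>j<k. cdot (v i) (X i j *v v j)) \<in> \<real>\<^sub>\<ge>\<^sub>0)"

definition completely_positive :: "('n::finite op \<Rightarrow> 'n op) \<Rightarrow> bool" where
  "completely_positive \<E> \<longleftrightarrow>
     (\<forall>k X. block_psd k X \<longrightarrow> block_psd k (\<lambda>i j. \<E> (X i j)))"

definition channel :: "('n::finite op \<Rightarrow> 'n op) \<Rightarrow> bool" where
  "channel \<E> \<longleftrightarrow> Vector_Spaces.linear scale_op scale_op \<E> \<and> completely_positive \<E> \<and>
     (\<forall>X. trace (\<E> X) = trace X)"

definition free_states :: "'n::finite op set \<Rightarrow> bool" where
  "free_states \<L> \<longleftrightarrow> \<L> \<noteq> {} \<and> closed \<L> \<and> convex \<L> \<and> (\<forall>\<rho>\<in>\<L>. state \<rho>)"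

definition free_channels :: "'n::finite op set \<Rightarrow> ('n op \<Rightarrow> 'n op) set" where
  "free_channels \<L> = {\<Omega>. channel \<Omega> \<and> (\<forall>\<rho>\<in>\<L>. \<Omega> \<rho> \<in> \<L>)}"


section \<open>Choi state\<close>

definition ketbra :: "complex^'n::finite \<Rightarrow> complex^'n \<Rightarrow> 'n op" where
  "ketbra v w = (\<chi> i j. v $ i * cnj (w $ j))"

definition max_ent :: "complex^('n::finite \<times> 'n)" where
  "max_ent = (\<chi> p. if fst p = snd p then complex_of_real (1 / sqrt (real CARD('n))) else 0)"

definition tensor_id ::
    "('n::finite op \<Rightarrow> 'n op) \<Rightarrow> ('n \<times> 'k::finite) op \<Rightarrow> ('n \<times> 'k) op" where
  "tensor_id \<E> X = (\<chi> p q. \<E> (\<chi> a a'. X $ (a, snd p) $ (a', snd q)) $ fst p $ fst q)"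

definition choi :: "('n::finite op \<Rightarrow> 'n op) \<Rightarrow> ('n \<times> 'n) op" where
  "choi \<E> = tensor_id \<E> (ketbra max_ent max_ent)"


section \<open>Generalized channel robustness\<close>

text \<open>The value is \<open>\<infinity>\<close> if no mixture of \<open>\<E>\<close> with a channel is free.\<close>

definition robustness :: "'n::finite op set \<Rightarrow> ('n op \<Rightarrow> 'n op) \<Rightarrow> ereal" where
  "robustness \<L> \<E> =
     Inf {ereal s |s. 0 \<le> s \<and>
       (\<exists>\<kappa>. channel \<kappa> \<and>
         (\<lambda>X. (1 / (1 + s)) *\<^sub>R (\<E> X + s *\<^sub>R \<kappa> X)) \<in> free_channels \<L>)}"

text \<open>The traces below are real, being traces of products of two hermitian operators.\<close>

definition optimal_witness ::
    "'n::finite op set \<Rightarrow> ('n op \<Rightarrow> 'n op) \<Rightarrow> ('n \<times> 'n) op \<Rightarrow> bool" where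
  "optimal_witness \<L> \<E> Z \<longleftrightarrow> psd Z \<and>
     (\<forall>\<Omega>\<in>free_channels \<L>. Re (trace (Z ** choi \<Omega>)) \<le> 1) \<and>
     ereal (Re (trace (Z ** choi \<E>)) - 1) = robustness \<L> \<E>"


section \<open>Thermodynamic quantities\<close>

text \<open>
  Functional calculus for a hermitian \<open>A\<close>: the unique operator acting as \<open>f c\<close> on the
  eigenspace of \<open>A\<close> for each eigenvalue \<open>c\<close>.
\<close>

definition herm_fun :: "(real \<Rightarrow> real) \<Rightarrow> 'n::finite op \<Rightarrow> 'n op" where
  "herm_fun f A = (THE B. \<forall>c v. A *v v = complex_of_real c *s v \<longrightarrow>
                                B *v v = complex_of_real (f c) *s v)"

text \<open>The factor \<open>\<rho>\<close> annihilates its kernel, so the convention \<open>0 log 0 = 0\<close> holds.\<close>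

definition entropy :: "'n::finite op \<Rightarrow> real" where
  "entropy \<rho> = - Re (trace (\<rho> ** herm_fun ln \<rho>))"

definition free_energy :: "real \<Rightarrow> 'n::finite op \<Rightarrow> 'n op \<Rightarrow> real" where
  "free_energy \<beta> H \<rho> = Re (trace (H ** \<rho>)) - (1 / \<beta>) * entropy \<rho>"

definition thermal :: "real \<Rightarrow> 'n::finite op \<Rightarrow> 'n op" where
  "thermal \<beta> H =
     (1 / Re (trace (herm_fun exp ((- \<beta>) *\<^sub>R H)))) *\<^sub>R herm_fun exp ((- \<beta>) *\<^sub>R H)"

definition work_cost :: "real \<Rightarrow> ('n::finite \<times> 'n) op \<Rightarrow> ('n op \<Rightarrow> 'n op) \<Rightarrow> real" where
  "work_cost \<beta> H \<E> = free_energy \<beta> H (choi \<E>) - free_energy \<beta> H (thermal \<beta> H)"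

definition min_eigenvalue :: "'n::finite op \<Rightarrow> real" where
  "min_eigenvalue H = Min {c. \<exists>v. v \<noteq> 0 \<and> H *v v = complex_of_real c *s v}"

definition work_cost_zero_temp :: "('n::finite \<times> 'n) op \<Rightarrow> ('n op \<Rightarrow> 'n op) \<Rightarrow> real" where
  "work_cost_zero_temp H \<E> = Re (trace (H ** choi \<E>)) - min_eigenvalue H"

text \<open>
  For the two work costs above (with \<open>\<beta> > 0\<close>) and nonempty \<open>free_channels \<L>\<close>, the supremum is a maximum over a
  compact set and all the quotients are nonnegative, so the real-valued \<open>SUP\<close> and \<open>INF\<close> are
  the intended ones.
\<close>

definition relative_cost ::
    "(('n::finite \<times> 'n) op \<Rightarrow> ('n op \<Rightarrow> 'n op) \<Rightarrow> real) \<Rightarrow>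
     'n op set \<Rightarrow> ('n op \<Rightarrow> 'n op) \<Rightarrow> real" where
  "relative_cost W \<L> \<E> =
     (INF H\<in>{H. psd H \<and> W H \<E> \<noteq> 0}. (SUP \<Omega>\<in>free_channels \<L>. W H \<Omega>) / W H \<E>)"

definition eta_cost :: "real \<Rightarrow> 'n::finite op set \<Rightarrow> ('n op \<Rightarrow> 'n op) \<Rightarrow> real" where
  "eta_cost \<beta> = relative_cost (work_cost \<beta>)"

definition eta_cost_zero_temp :: "'n::finite op set \<Rightarrow> ('n op \<Rightarrow> 'n op) \<Rightarrow> real" where
  "eta_cost_zero_temp = relative_cost work_cost_zero_temp"

end

theory Submission
  imports Defs
begin

text \<open>
  Use the Hamiltonian \<open>H = \<lambda> Z\<close>. Every free channel costs at most \<open>\<lambda> - F\<close>, where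
  \<open>F = Tr (H \<tau>) - S(\<tau>) / \<beta>\<close> is the equilibrium free energy, because its Choi state has energy at most
  \<open>\<lambda>\<close> and nonnegative entropy, while \<open>\<E>\<close> costs exactly \<open>\<lambda> (1 + R) - S(J) / \<beta> - F\<close>. The hypothesis
  on \<open>\<lambda>\<close> makes the second number at least the first, so dropping the term \<open>Tr (H \<tau>) \<ge> 0\<close> from both
  numerator and denominator can only increase the ratio.

  That \<open>H\<close> is admissible, i.e. that the denominator is positive, follows from \<open>\<lambda> > F\<close>: as the space
  is not one-dimensional, the partition function strictly exceeds \<open>exp (- \<beta> h)\<close> for the ground energy
  \<open>h\<close>, and \<open>h \<le> \<lambda>\<close> since the identity is a free channel. At zero temperature it follows from
  \<open>R > 0\<close>, which holds because the set of free states is closed. Since the infimum is taken over the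
  reals, a lower bound for all quotients is needed as well; it is provided by the Gibbs variational
  principle.
\<close>

subsection \<open>Spectral theorem\<close>

lemma cdot_add_right: "cdot v (w + x) = cdot v w + cdot v x"
  by (simp add: cdot_def algebra_simps sum.distrib)

lemma cdot_add_left: "cdot (v + w) x = cdot v x + cdot w x"
  by (simp add: cdot_def algebra_simps sum.distrib)

lemma cdot_scale_right: "cdot v (c *s w) = c * cdot v w"
  by (simp add: cdot_def algebra_simps sum_distrib_left)

lemma cdot_scale_left: "cdot (c *s v) w = cnj c * cdot v w"
  by (simp add: cdot_def algebra_simps sum_distrib_left)

lemma cdot_sum_right: "cdot v (\<Sum>k\<in>K. f k) = (\<Sum>k\<in>K. cdot v (f k))"
proof -
  have "cdot v (\<Sum>k\<in>K. f k) = (\<Sum>i\<in>UNIV. \<Sum>k\<in>K. cnj (v $ i) * f k $ i)"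
    by (simp add: cdot_def sum_distrib_left)
  also have "\<dots> = (\<Sum>k\<in>K. \<Sum>i\<in>UNIV. cnj (v $ i) * f k $ i)"
    by (rule sum.swap)
  finally show ?thesis by (simp add: cdot_def)
qed

lemma cnj_cdot: "cnj (cdot v w) = cdot w v"
  by (simp add: cdot_def algebra_simps)

lemma Re_cdot: "Re (cdot v w) = v \<bullet> w"
  by (simp add: cdot_def inner_vec_def inner_complex_def)

lemma cdot_self: "cdot v v = complex_of_real ((norm v)\<^sup>2)"
proof (rule complex_eqI)
  show "Im (cdot v v) = Im (complex_of_real ((norm v)\<^sup>2))"
    by (simp add: cdot_def)
qed (simp add: Re_cdot power2_norm_eq_inner)

lemma of_real_scale: "complex_of_real r *s v = r *\<^sub>R v"
  by (simp add: vec_eq_iff complex_eq_iff)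

definition hermitian :: "'n::finite op \<Rightarrow> bool" where
  "hermitian A \<longleftrightarrow> (\<forall>v w. cdot v (A *v w) = cdot (A *v v) w)"

text \<open>The defect \<open>h\<close> vanishes on the diagonal because the quadratic form is real.
  Polarising at \<open>v + w\<close> makes \<open>h\<close> antisymmetric, and together with
  conjugation this makes all its values real. Since \<open>h\<close> is complex linear in its second
  argument, \<open>\<i> * h v w\<close> is real as well, so \<open>h\<close> is zero.\<close>

lemma psd_imp_hermitian:
  assumes "psd A"
  shows "hermitian A"
proof -
  define h where "h v w = cdot v (A *v w) - cdot (A *v v) w" for v w
  have h0: "h v v = 0" for v
  proof -
    have "Im (cdot v (A *v v)) = 0"
      using assms by (simp add: psd_def complex_nonneg_Reals_iff)
    then have "cnj (cdot v (A *v v)) = cdot v (A *v v)"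
      by (simp add: complex_eq_iff)
    then show ?thesis by (simp add: h_def cnj_cdot)
  qed
  have anti: "h w v = - h v w" for v w
  proof -
    have "h (v + w) (v + w) = h v v + h v w + h w v + h w w"
      by (simp add: h_def cdot_add_left cdot_add_right matrix_vector_right_distrib)
    then show ?thesis by (simp add: h0 eq_neg_iff_add_eq_0 add.commute)
  qed
  have cn: "cnj (h v w) = h v w" for v w
  proof -
    have "cnj (h v w) = - h w v"
      by (simp add: h_def cnj_cdot)
    then show ?thesis using anti[of v w] by simp
  qed
  have "h v w = 0" for v w
  proof -
    have "h v (\<i> *s w) = \<i> * h v w"
      by (simp add: h_def cdot_scale_right vector_scalar_commute algebra_simps)
    then show ?thesis
      using cn[of v w] cn[of v "\<i> *s w"] by (auto simp: complex_eq_iff)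
  qed
  then show ?thesis by (simp add: hermitian_def h_def)
qed

section \<open>Orthonormal bases and operators diagonal in them\<close>

definition onb :: "('n::finite \<Rightarrow> complex^'n) \<Rightarrow> bool" where
  "onb u \<longleftrightarrow> (\<forall>i j. cdot (u i) (u j) = of_bool (i = j))"

text \<open>Spectral form with eigenbasis \<open>u\<close> and real eigenvalues
  \<open>\<mu>\<close>. Once an operator is written this way, traces, functional calculus and
  entropy reduce to finite real sums.\<close>

definition diag_op :: "('n::finite \<Rightarrow> complex^'n) \<Rightarrow> ('n \<Rightarrow> real) \<Rightarrow> 'n op" where
  "diag_op u \<mu> = (\<Sum>k\<in>UNIV. \<mu> k *\<^sub>R ketbra (u k) (u k))"

lemma diag_op_nth:
  "diag_op u \<mu> $ a $ b = (\<Sum>k\<in>UNIV. complex_of_real (\<mu> k) * (u k $ a * cnj (u k $ b)))"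
  by (simp add: diag_op_def ketbra_def scaleR_conv_of_real[where ?'a = complex])

text \<open>Orthonormality says that the conjugate transpose \<open>V\<close> is a left inverse of
  the matrix \<open>U\<close> with columns \<open>u k\<close>. For square matrices it is then a
  right inverse too, which is the completeness relation.\<close>

lemma onb_complete:
  assumes "onb u"
  shows "(\<Sum>k\<in>UNIV. u k $ a * cnj (u k $ b)) = of_bool (a = b)"
proof -
  define U where "U = (\<chi> i k. u k $ i)"
  define V where "V = (\<chi> k i. cnj (u k $ i))"
  have "V ** U = mat 1"
    using assms by (simp add: V_def U_def vec_eq_iff matrix_matrix_mult_def mat_def onb_def cdot_def)
  then have "U ** V = mat 1"
    by (simp add: matrix_left_right_inverse)
  then have "(U ** V) $ a $ b = (mat 1 :: complex^'a^'a) $ a $ b" by simp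
  then show ?thesis
    by (simp add: V_def U_def matrix_matrix_mult_def mat_def of_bool_def split: if_splits)
qed

lemma onb_expand:
  assumes "onb u"
  shows "v = (\<Sum>k\<in>UNIV. cdot (u k) v *s u k)"
proof -
  have "(\<Sum>k\<in>UNIV. cdot (u k) v *s u k) $ a = v $ a" for a
  proof -
    have "(\<Sum>k\<in>UNIV. cdot (u k) v *s u k) $ a
        = (\<Sum>k\<in>UNIV. \<Sum>b\<in>UNIV. (u k $ a * cnj (u k $ b)) * v $ b)"
      by (simp add: cdot_def sum_distrib_left sum_distrib_right mult_ac)
    also have "\<dots> = (\<Sum>b\<in>UNIV. (\<Sum>k\<in>UNIV. u k $ a * cnj (u k $ b)) * v $ b)"
      by (subst sum.swap) (simp add: sum_distrib_right)
    also have "\<dots> = (\<Sum>b\<in>UNIV. of_bool (a = b) * v $ b)"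
      by (simp only: onb_complete[OF assms])
    finally show ?thesis by (simp add: of_bool_def if_distrib[of "\<lambda>x. x * _"] cong: if_cong)
  qed
  then show ?thesis by (simp add: vec_eq_iff)
qed

lemma diag_op_mult_vec: "diag_op u \<mu> *v v = (\<Sum>k\<in>UNIV. (complex_of_real (\<mu> k) * cdot (u k) v) *s u k)"
proof -
  have "(diag_op u \<mu> *v v) $ a = (\<Sum>b\<in>UNIV. \<Sum>k\<in>UNIV. complex_of_real (\<mu> k) * (u k $ a * cnj (u k $ b)) * v $ b)" for a
    by (simp add: matrix_vector_mult_def diag_op_nth sum_distrib_right)
  also have "\<dots> a = (\<Sum>k\<in>UNIV. (complex_of_real (\<mu> k) * cdot (u k) v) *s u k) $ a" for a
    by (subst sum.swap) (simp add: cdot_def sum_distrib_left sum_distrib_right mult_ac)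
  finally show ?thesis by (simp add: vec_eq_iff)
qed

lemma cdot_diag_op:
  assumes "onb u"
  shows "cdot (u k) (diag_op u \<mu> *v v) = complex_of_real (\<mu> k) * cdot (u k) v"
  using assms
  by (simp add: diag_op_mult_vec cdot_sum_right cdot_scale_right onb_def of_bool_def
      if_distrib[of "(*) _"] cong: if_cong)

lemma diag_op_eigenvector:
  assumes "onb u"
  shows "diag_op u \<mu> *v u k = complex_of_real (\<mu> k) *s u k"
proof -
  have "diag_op u \<mu> *v u k = (\<Sum>j\<in>UNIV. if j = k then complex_of_real (\<mu> k) *s u k else 0)"
    unfolding diag_op_mult_vec using assms by (intro sum.cong) (auto simp: onb_def)
  then show ?thesis by simp
qed

lemma matrix_eq_onb:
  assumes "onb u" "\<And>k. A *v u k = B *v u k"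
  shows "A = B"
proof -
  have "A *v v = B *v v" for v
  proof -
    have "A *v (\<Sum>k\<in>UNIV. cdot (u k) v *s u k) = B *v (\<Sum>k\<in>UNIV. cdot (u k) v *s u k)"
      by (simp add: vec.linear_sum[OF matrix_vector_mul_linear_gen] assms(2) vector_scalar_commute)
    then show ?thesis using onb_expand[OF assms(1), of v] by simp
  qed
  then show ?thesis by (simp add: matrix_eq)
qed

text \<open>The new eigenvector maximises the Rayleigh quotient on the orthogonal complement of the given
  ones.\<close>

lemma hermitian_eigenvector_orthogonal:
  fixes A :: "'n::finite op"
  assumes A: "hermitian A" and I: "finite I" "card I < CARD('n)"
    and eig: "\<And>i. i \<in> I \<Longrightarrow> A *v u i = complex_of_real (\<mu> i) *s u i"
  obtains v c where "norm v = 1" "\<And>i. i \<in> I \<Longrightarrow> cdot (u i) v = 0"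
    "A *v v = complex_of_real c *s v"
proof -
  define W where "W = {v. \<forall>i\<in>I. cdot (u i) v = 0}"
  \<comment> \<open>The Euclidean inner product is only the real part of \<open>cdot\<close>;
    including the multiples by \<open>\<i>\<close> turns real orthogonality to \<open>S\<close> into
    complex orthogonality to every \<open>u i\<close>. The span has real dimension at most twice
    \<open>card I\<close>, below the real dimension of the whole space.\<close>
  define S where "S = u ` I \<union> (\<lambda>i. \<i> *s u i) ` I"
  have "card S \<le> card I + card I"
    unfolding S_def
    by (intro order_trans[OF card_Un_le] add_mono card_image_le I)
  then have "dim S < DIM(complex^'n)"
    using dim_le_card'[of S] I by (simp add: S_def)
  then obtain x where x: "x \<noteq> 0" "\<And>y. y \<in> span S \<Longrightarrow> orthogonal x y"
    using orthogonal_to_subspace_exists by blast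
  have xW: "x \<in> W"
    unfolding W_def
  proof safe
    fix i assume i: "i \<in> I"
    have "orthogonal x (u i)" "orthogonal x (\<i> *s u i)"
      using i by (auto intro!: x(2) span_base simp: S_def)
    then have "Re (cdot (u i) x) = 0" "Re (cdot (\<i> *s u i) x) = 0"
      by (simp_all add: Re_cdot orthogonal_def inner_commute)
    then show "cdot (u i) x = 0"
      by (simp add: cdot_scale_left complex_eq_iff)
  qed
  have W_scale: "r *\<^sub>R w \<in> W" if "w \<in> W" for r w
    using that by (simp add: W_def of_real_scale[symmetric] cdot_scale_right)
  have W_add: "w + y \<in> W" if "w \<in> W" "y \<in> W" for w y
    using that by (simp add: W_def cdot_add_right)
  have W_A: "A *v w \<in> W" if "w \<in> W" for w
    using that A by (auto simp: W_def hermitian_def eig cdot_scale_left)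
  define q where "q v = Re (cdot v (A *v v))" for v
  have q_scale: "q (r *\<^sub>R v) = r\<^sup>2 * q v" for r v
    by (simp add: q_def of_real_scale[symmetric] vector_scalar_commute cdot_scale_left
        cdot_scale_right power2_eq_square)
  define K where "K = sphere 0 1 \<inter> W"
  have "closed {v. cdot w v = 0}" for w :: "complex^'n"
    unfolding cdot_def by (intro closed_Collect_eq continuous_intros)
  moreover have "W = (\<Inter>i\<in>I. {v. cdot (u i) v = 0})"
    by (auto simp: W_def)
  ultimately have "closed W" by (simp add: closed_INT)
  then have "compact K"
    unfolding K_def by (intro compact_Int_closed compact_sphere)
  moreover have "(1 / norm x) *\<^sub>R x \<in> K"
    using x(1) W_scale[OF xW] by (simp add: K_def)
  moreover have "continuous_on K q"
    unfolding q_def cdot_def matrix_vector_mult_def by (simp, intro continuous_intros)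
  ultimately obtain v where v: "v \<in> K" and max: "\<And>w. w \<in> K \<Longrightarrow> q w \<le> q v"
    using continuous_attains_sup[of K q] by blast
  define c where "c = q v"
  have nv: "norm v = 1" and vW: "v \<in> W" using v by (auto simp: K_def)
  have bound: "q w \<le> c * (norm w)\<^sup>2" if "w \<in> W" for w
  proof (cases "w = 0")
    case False
    have "q ((1 / norm w) *\<^sub>R w) \<le> c"
      unfolding c_def using False W_scale[OF that] by (intro max) (simp add: K_def)
    then show ?thesis using False by (simp add: q_scale field_simps)
  qed (simp add: q_def cdot_def)
  \<comment> \<open>The residual of the eigenvalue equation at the maximiser. It lies in
    \<open>W\<close>, so \<open>v\<close> may be perturbed in its direction, and maximality will
    force it to vanish.\<close>
  define y where "y = A *v v - c *\<^sub>R v"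
  have yW: "y \<in> W"
    using W_add[OF W_A[OF vW] W_scale[OF vW, of "-c"]] by (simp add: y_def)
  define N where "N = (norm y)\<^sup>2"
  define M where "M = c * N - q y"
  \<comment> \<open>Comparing \<open>q\<close> at \<open>v + t y\<close> with its bound
    \<open>c\<close> times the squared norm, the terms of order zero cancel and the first-order term
    that survives is \<open>2 * t * N\<close>.\<close>
  have key: "2 * t * N \<le> t\<^sup>2 * M" for t
  proof -
    have "q (v + t *\<^sub>R y) = c + 2 * t * Re (cdot y (A *v v)) + t\<^sup>2 * q y"
    proof -
      have "cdot v (A *v y) = cnj (cdot y (A *v v))"
        using A by (simp add: cnj_cdot hermitian_def)
      then show ?thesis
        by (simp add: q_def c_def of_real_scale[symmetric] vector_scalar_commute cdot_add_left cdot_add_right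
            cdot_scale_left cdot_scale_right matrix_vector_right_distrib power2_eq_square algebra_simps)
    qed
    moreover have "(norm (v + t *\<^sub>R y))\<^sup>2 = 1 + 2 * t * (v \<bullet> y) + t\<^sup>2 * N"
    proof -
      have "v \<bullet> v = 1" using nv by (simp add: dot_square_norm)
      then show ?thesis
        unfolding N_def power2_norm_eq_inner
        by (simp add: inner_add_left inner_add_right inner_commute power2_eq_square algebra_simps)
    qed
    moreover have "Re (cdot y (A *v v)) = c * (v \<bullet> y) + N"
    proof -
      have "y \<bullet> (y + c *\<^sub>R v) = c * (v \<bullet> y) + N"
        by (simp add: N_def power2_norm_eq_inner inner_add_right inner_commute)
      then show ?thesis by (simp add: Re_cdot y_def)
    qed
    moreover have "q (v + t *\<^sub>R y) \<le> c * (norm (v + t *\<^sub>R y))\<^sup>2"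
      by (intro bound W_add vW W_scale yW)
    ultimately show ?thesis by (simp add: M_def algebra_simps)
  qed
  have "N = 0"
  proof (rule ccontr)
    assume "N \<noteq> 0"
    then have N: "N > 0" by (simp add: N_def)
    \<comment> \<open>Any positive number above \<open>M\<close> would do. At
      \<open>t = N / m\<close> the inequality \<open>key\<close> gives \<open>2 * m \<le> M\<close>,
      which is absurd.\<close>
    define m where "m = \<bar>M\<bar> + 1"
    have m: "m > 0" "M < m" by (auto simp: m_def)
    have "2 * (N / m) * N * m\<^sup>2 \<le> (N / m)\<^sup>2 * M * m\<^sup>2"
      by (intro mult_right_mono key) auto
    then have "N\<^sup>2 * (2 * m) \<le> N\<^sup>2 * M"
      using m by (simp add: power2_eq_square field_simps)
    then have "2 * m \<le> M" using N by simp
    then show False using m by simp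
  qed
  then have "A *v v = complex_of_real c *s v"
    by (simp add: N_def y_def of_real_scale)
  then show thesis using nv vW by (intro that) (auto simp: W_def)
qed

text \<open>Induction over the finite subsets of the index type extends an orthonormal family of
  eigenvectors one vector at a time until it is indexed by the whole type and hence a basis.\<close>

lemma spectral_theorem:
  fixes A :: "'n::finite op"
  assumes "hermitian A"
  obtains u \<mu> where "onb u" "A = diag_op u \<mu>"
proof -
  have "finite I \<Longrightarrow> \<exists>u \<mu>. (\<forall>i\<in>I. A *v u i = complex_of_real (\<mu> i) *s u i) \<and>
      (\<forall>i\<in>I. \<forall>j\<in>I. cdot (u i) (u j) = of_bool (i = j))" for I :: "'n set"
  proof (induction I rule: finite_induct)
    case (insert k I)
    then obtain u \<mu> where u: "\<And>i. i \<in> I \<Longrightarrow> A *v u i = complex_of_real (\<mu> i) *s u i"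
      "\<And>i j. i \<in> I \<Longrightarrow> j \<in> I \<Longrightarrow> cdot (u i) (u j) = of_bool (i = j)"
      by blast
    have "card I < CARD('n)"
      using insert by (intro psubset_card_mono) auto
    then obtain v c where v: "norm v = 1" "\<And>i. i \<in> I \<Longrightarrow> cdot (u i) v = 0"
      "A *v v = complex_of_real c *s v"
      using hermitian_eigenvector_orthogonal[OF assms \<open>finite I\<close>] u(1) by metis
    have "cdot v v = 1" "\<And>i. i \<in> I \<Longrightarrow> cdot v (u i) = 0"
      using v(1,2) cnj_cdot[of "u i" v for i] by (auto simp: cdot_self simp flip: cnj_cdot[of "u _" v])
    then show ?case
      using u v insert.hyps
      by (intro exI[of _ "u(k := v)"] exI[of _ "\<mu>(k := c)"]) auto
  qed auto
  from this[of UNIV] obtain u \<mu> where u: "\<And>i. A *v u i = complex_of_real (\<mu> i) *s u i"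
      "onb u"
    by (auto simp: onb_def)
  then have "A = diag_op u \<mu>"
    by (intro matrix_eq_onb[OF u(2)]) (simp add: diag_op_eigenvector)
  then show thesis using u that by blast
qed

subsection \<open>States, entropy and free energy\<close>

lemma parseval:
  assumes "onb u"
  shows "(\<Sum>k\<in>UNIV. (cmod (cdot (u k) v))\<^sup>2) = (norm v)\<^sup>2"
proof -
  have "cdot v v = (\<Sum>k\<in>UNIV. cdot (u k) v * cdot v (u k))"
    by (subst (2) onb_expand[OF assms, of v]) (simp only: cdot_sum_right cdot_scale_right)
  also have "\<dots> = complex_of_real (\<Sum>k\<in>UNIV. (cmod (cdot (u k) v))\<^sup>2)"
    by (simp only: of_real_sum complex_norm_square cnj_cdot)
  finally show ?thesis
    by (simp only: cdot_self of_real_eq_iff)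
qed

lemma onb_norm: "onb u \<Longrightarrow> norm (u k) = 1"
  using cdot_self[of "u k"]
  by (simp add: onb_def power2_eq_1_iff flip: of_real_power)
    (use norm_ge_zero[of "u k"] in linarith)

lemma trace_diag_op_mult:
  "trace (diag_op u \<mu> ** X) = (\<Sum>k\<in>UNIV. complex_of_real (\<mu> k) * cdot (u k) (X *v u k))"
proof -
  have "trace (diag_op u \<mu> ** X)
      = (\<Sum>a\<in>UNIV. \<Sum>b\<in>UNIV. \<Sum>k\<in>UNIV. complex_of_real (\<mu> k) * (cnj (u k $ b) * (X $ b $ a * u k $ a)))"
    by (simp add: trace_def matrix_matrix_mult_def diag_op_nth sum_distrib_right sum_distrib_left mult_ac)
  also have "\<dots> = (\<Sum>a\<in>UNIV. \<Sum>k\<in>UNIV. \<Sum>b\<in>UNIV. complex_of_real (\<mu> k) * (cnj (u k $ b) * (X $ b $ a * u k $ a)))"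
    by (intro sum.cong refl sum.swap)
  also have "\<dots> = (\<Sum>k\<in>UNIV. \<Sum>a\<in>UNIV. \<Sum>b\<in>UNIV. complex_of_real (\<mu> k) * (cnj (u k $ b) * (X $ b $ a * u k $ a)))"
    by (rule sum.swap)
  also have "\<dots> = (\<Sum>k\<in>UNIV. \<Sum>b\<in>UNIV. \<Sum>a\<in>UNIV. complex_of_real (\<mu> k) * (cnj (u k $ b) * (X $ b $ a * u k $ a)))"
    by (intro sum.cong refl sum.swap)
  finally show ?thesis
    by (simp add: cdot_def matrix_vector_mult_def sum_distrib_left)
qed

lemma diag_op_one:
  assumes "onb u"
  shows "diag_op u (\<lambda>_. 1) = mat 1"
  using onb_complete[OF assms] by (simp add: vec_eq_iff diag_op_nth mat_def)

lemma trace_onb: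
  assumes "onb u"
  shows "trace X = (\<Sum>k\<in>UNIV. cdot (u k) (X *v u k))"
  using trace_diag_op_mult[of u "\<lambda>_. 1" X] by (simp add: diag_op_one[OF assms])

lemma trace_diag_op:
  assumes "onb u"
  shows "trace (diag_op u \<mu>) = complex_of_real (\<Sum>k\<in>UNIV. \<mu> k)"
  using assms by (simp add: trace_onb[OF assms] cdot_diag_op onb_def)

lemma scaleR_diag_op: "c *\<^sub>R diag_op u \<mu> = diag_op u (\<lambda>k. c * \<mu> k)"
  by (simp add: diag_op_def scaleR_sum_right)

lemma cdot_diag_op_self:
  "cdot v (diag_op u \<mu> *v v) = complex_of_real (\<Sum>k\<in>UNIV. \<mu> k * (cmod (cdot (u k) v))\<^sup>2)"
  by (simp only: diag_op_mult_vec cdot_sum_right cdot_scale_right of_real_sum of_real_mult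
      complex_norm_square cnj_cdot mult.assoc)

lemma psd_diag_op_iff:
  assumes "onb u"
  shows "psd (diag_op u \<mu>) \<longleftrightarrow> (\<forall>k. 0 \<le> \<mu> k)"
proof
  assume "psd (diag_op u \<mu>)"
  then have "cdot (u k) (diag_op u \<mu> *v u k) \<in> \<real>\<^sub>\<ge>\<^sub>0" for k
    by (simp add: psd_def)
  then show "\<forall>k. 0 \<le> \<mu> k"
    using assms by (simp add: cdot_diag_op onb_def)
qed (simp add: psd_def cdot_diag_op_self sum_nonneg del: of_real_sum of_real_mult of_real_power)

lemma psd_spectral:
  assumes "psd A"
  obtains u \<mu> where "onb u" "A = diag_op u \<mu>" "\<And>k. 0 \<le> \<mu> k"
  using spectral_theorem[OF psd_imp_hermitian[OF assms]] psd_diag_op_iff assms by metis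

lemma state_spectral:
  assumes "state \<rho>"
  obtains u p where "onb u" "\<rho> = diag_op u p" "\<And>k. 0 \<le> p k" "(\<Sum>k\<in>UNIV. p k) = 1"
proof -
  from assms have "psd \<rho>" "trace \<rho> = 1" by (auto simp: state_def)
  from psd_spectral[OF this(1)] obtain u p where
    u: "onb u" "\<rho> = diag_op u p" "\<And>k. 0 \<le> p k" by blast
  moreover have "(\<Sum>k\<in>UNIV. p k) = 1"
    using \<open>trace \<rho> = 1\<close> trace_diag_op[OF u(1), of p] u(2) of_real_eq_1_iff by metis
  ultimately show thesis by (rule that)
qed

text \<open>The weights \<open>r k\<close> are the outcome probabilities of a measurement of \<rho>
  in the basis \<open>u\<close>. They do not depend on \<open>h\<close>, so each expectation is an
  average of eigenvalues.\<close>

lemma state_expectation: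
  assumes "state \<rho>" "onb u"
  obtains r where "\<And>k. 0 \<le> r k" "(\<Sum>k\<in>UNIV. r k) = 1"
    "\<And>h. Re (trace (diag_op u h ** \<rho>)) = (\<Sum>k\<in>UNIV. h k * r k)"
proof
  let ?r = "\<lambda>k. Re (cdot (u k) (\<rho> *v u k))"
  show "0 \<le> ?r k" for k
    using assms(1) by (simp add: state_def psd_def complex_nonneg_Reals_iff)
  show "(\<Sum>k\<in>UNIV. ?r k) = 1"
    using assms(1) by (simp add: state_def trace_onb[OF assms(2)] flip: Re_sum)
  show "Re (trace (diag_op u h ** \<rho>)) = (\<Sum>k\<in>UNIV. h k * ?r k)" for h
    by (simp add: trace_diag_op_mult)
qed

lemma state_expectation_ge:
  assumes "state \<rho>" "onb u" "\<And>k. m \<le> h k"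
  shows "m \<le> Re (trace (diag_op u h ** \<rho>))"
proof -
  obtain r where r: "\<And>k. 0 \<le> r k" "(\<Sum>k\<in>UNIV. r k) = 1"
    "\<And>h. Re (trace (diag_op u h ** \<rho>)) = (\<Sum>k\<in>UNIV. h k * r k)"
    using state_expectation[OF assms(1,2)] by blast
  have "m = (\<Sum>k\<in>UNIV. m * r k)" by (simp add: r(2) flip: sum_distrib_left)
  also have "\<dots> \<le> (\<Sum>k\<in>UNIV. h k * r k)"
    by (intro sum_mono mult_right_mono assms r)
  finally show ?thesis by (simp add: r(3))
qed

lemma state_expectation_le:
  assumes "state \<rho>" "onb u" "\<And>k. h k \<le> m"
  shows "Re (trace (diag_op u h ** \<rho>)) \<le> m"
proof -
  obtain r where r: "\<And>k. 0 \<le> r k" "(\<Sum>k\<in>UNIV. r k) = 1"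
    "\<And>h. Re (trace (diag_op u h ** \<rho>)) = (\<Sum>k\<in>UNIV. h k * r k)"
    using state_expectation[OF assms(1,2)] by blast
  have "(\<Sum>k\<in>UNIV. h k * r k) \<le> (\<Sum>k\<in>UNIV. m * r k)"
    by (intro sum_mono mult_right_mono assms r)
  also have "\<dots> = m" by (simp add: r(2) flip: sum_distrib_left)
  finally show ?thesis by (simp add: r(3))
qed

text \<open>This resolves the definite description in \<open>herm_fun\<close>. Uniqueness holds
  because the values on the eigenbasis \<open>u\<close> are prescribed; existence requires the rule
  to hold for all eigenvectors, including combinations within a degenerate eigenspace.\<close>

lemma herm_fun_diag_op:
  assumes u: "onb u"
  shows "herm_fun f (diag_op u \<mu>) = diag_op u (\<lambda>k. f (\<mu> k))"
  unfolding herm_fun_def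
proof (rule the_equality)
  show "\<forall>c v. diag_op u \<mu> *v v = complex_of_real c *s v \<longrightarrow>
      diag_op u (\<lambda>k. f (\<mu> k)) *v v = complex_of_real (f c) *s v"
  proof (intro allI impI)
    fix c v
    assume v: "diag_op u \<mu> *v v = complex_of_real c *s v"
    \<comment> \<open>An eigenvector for \<open>c\<close> has components only along those
      \<open>u k\<close> with \<open>\<mu> k = c\<close>; for every other \<open>k\<close> both
      sides are zero.\<close>
    have *: "complex_of_real (f (\<mu> k)) * cdot (u k) v = complex_of_real (f c) * cdot (u k) v" for k
      using arg_cong[OF v, of "cdot (u k)"] by (auto simp: cdot_diag_op[OF u] cdot_scale_right)
    have "diag_op u (\<lambda>k. f (\<mu> k)) *v v = (\<Sum>k\<in>UNIV. (complex_of_real (f c) * cdot (u k) v) *s u k)"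
      unfolding diag_op_mult_vec * ..
    also have "\<dots> = complex_of_real (f c) *s (\<Sum>k\<in>UNIV. cdot (u k) v *s u k)"
      by (simp add: vec.scale_sum_right)
    finally show "diag_op u (\<lambda>k. f (\<mu> k)) *v v = complex_of_real (f c) *s v"
      using onb_expand[OF u, of v] by simp
  qed
next
  fix B
  assume "\<forall>c v. diag_op u \<mu> *v v = complex_of_real c *s v \<longrightarrow> B *v v = complex_of_real (f c) *s v"
  then show "B = diag_op u (\<lambda>k. f (\<mu> k))"
    by (intro matrix_eq_onb[OF u]) (simp add: diag_op_eigenvector[OF u])
qed

section \<open>Entropy, thermal states and the Gibbs variational principle\<close>

lemma entropy_diag_op:
  assumes u: "onb u"
  shows "entropy (diag_op u p) = - (\<Sum>k\<in>UNIV. p k * ln (p k))"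
  using u by (simp add: entropy_def herm_fun_diag_op trace_diag_op_mult cdot_diag_op onb_def)

lemma entropy_nonneg:
  assumes "state \<rho>"
  shows "0 \<le> entropy \<rho>"
proof -
  obtain u p where p: "onb u" "\<rho> = diag_op u p" "\<And>k. 0 \<le> p k" "(\<Sum>k\<in>UNIV. p k) = 1"
    using state_spectral[OF assms] by blast
  have "p k \<le> 1" for k
    using member_le_sum[of k UNIV p] p by simp
  then have "p k * ln (p k) \<le> 0" for k
    using p(3)[of k] by (cases "p k = 0") (auto intro: mult_nonneg_nonpos)
  then show ?thesis
    by (simp add: p(2) entropy_diag_op[OF p(1)] sum_nonpos)
qed

definition partition_fun :: "real \<Rightarrow> ('n::finite \<Rightarrow> real) \<Rightarrow> real" where
  "partition_fun \<beta> h = (\<Sum>k\<in>UNIV. exp (- \<beta> * h k))"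

lemma partition_fun_pos: "0 < partition_fun \<beta> h"
  unfolding partition_fun_def by (intro sum_pos) auto

lemma thermal_diag_op:
  assumes "onb u"
  shows "thermal \<beta> (diag_op u h) = diag_op u (\<lambda>k. exp (- \<beta> * h k) / partition_fun \<beta> h)"
  using assms
  by (simp add: thermal_def scaleR_diag_op herm_fun_diag_op trace_diag_op partition_fun_def
      del: scaleR_minus_left)

lemma state_thermal:
  assumes "onb u"
  shows "state (thermal \<beta> (diag_op u h))"
  using assms partition_fun_pos[of \<beta> h]
  by (simp add: thermal_diag_op state_def psd_diag_op_iff trace_diag_op less_imp_le
      flip: sum_divide_distrib) (simp add: partition_fun_def flip: of_real_sum)

text \<open>The logarithm of a Boltzmann weight is affine in the energy, so the entropy is \<beta>
  times the mean energy plus the logarithm of the partition function, and the mean energy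
  cancels.\<close>

lemma free_energy_thermal:
  assumes u: "onb u" and \<beta>: "0 < \<beta>"
  shows "free_energy \<beta> (diag_op u h) (thermal \<beta> (diag_op u h)) = - (1 / \<beta>) * ln (partition_fun \<beta> h)"
proof -
  let ?P = "partition_fun \<beta> h"
  let ?q = "\<lambda>k. exp (- \<beta> * h k) / ?P"
  have P: "0 < ?P" by (rule partition_fun_pos)
  have q1: "(\<Sum>k\<in>UNIV. ?q k) = 1"
    using P by (simp add: partition_fun_def flip: sum_divide_distrib)
  have "?q k * ln (?q k) = - \<beta> * (h k * ?q k) - ln ?P * ?q k" for k
    using P by (simp add: ln_div algebra_simps diff_divide_distrib)
  then have "(\<Sum>k\<in>UNIV. ?q k * ln (?q k)) = - \<beta> * (\<Sum>k\<in>UNIV. h k * ?q k) - ln ?P * (\<Sum>k\<in>UNIV. ?q k)"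
    by (simp only: sum_distrib_left sum_subtractf)
  then have S: "entropy (diag_op u ?q) = \<beta> * (\<Sum>k\<in>UNIV. h k * ?q k) + ln ?P"
    unfolding entropy_diag_op[OF u] q1 by simp
  have "Re (trace (diag_op u h ** diag_op u ?q)) = (\<Sum>k\<in>UNIV. h k * ?q k)"
    using u by (simp add: trace_diag_op_mult cdot_diag_op onb_def)
  then show ?thesis
    unfolding free_energy_def thermal_diag_op[OF u] S using \<beta> by (simp add: field_simps)
qed

text \<open>The scalar form of Klein's inequality: \<open>ln x \<le> x - 1\<close> at
  \<open>x = q / p\<close>, multiplied by \<open>p\<close>.\<close>

lemma xlogx_ge:
  fixes p q :: real
  assumes "0 \<le> p" "0 < q"
  shows "p - q \<le> p * (ln p - ln q)"
proof (cases "p = 0")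
  case False
  then have "ln (q / p) \<le> q / p - 1"
    using assms by (intro ln_le_minus_one) auto
  then have "p * ln (q / p) \<le> p * (q / p - 1)"
    using assms by (intro mult_left_mono)
  then show ?thesis
    using False assms by (simp add: ln_div algebra_simps diff_divide_distrib)
qed (use assms in auto)

text \<open>The overlaps \<open>D i j\<close> of the two eigenbases form a doubly stochastic matrix, which reduces the
  inequality to its scalar version.\<close>

lemma free_energy_ge_thermal:
  assumes \<rho>: "state \<rho>" and u: "onb u" and \<beta>: "0 < \<beta>"
  shows "free_energy \<beta> (diag_op u h) (thermal \<beta> (diag_op u h)) \<le> free_energy \<beta> (diag_op u h) \<rho>"
proof -
  obtain w p where w: "onb w" "\<rho> = diag_op w p" and p: "\<And>k. 0 \<le> p k" "(\<Sum>k\<in>UNIV. p k) = 1"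
    using state_spectral[OF \<rho>] by blast
  let ?P = "partition_fun \<beta> h"
  define q where "q j = exp (- \<beta> * h j) / ?P" for j
  define D where "D i j = (cmod (cdot (w i) (u j)))\<^sup>2" for i j
  have P: "0 < ?P" by (rule partition_fun_pos)
  have q: "0 < q j" "ln (q j) = - \<beta> * h j - ln ?P" for j
    using P by (simp_all add: q_def ln_div)
  have q1: "(\<Sum>j\<in>UNIV. q j) = 1"
    using P unfolding q_def by (simp add: partition_fun_def flip: sum_divide_distrib)
  have col: "(\<Sum>i\<in>UNIV. D i j) = 1" for j
    unfolding D_def using parseval[OF w(1), of "u j"] onb_norm[OF u, of j] by simp
  have row: "(\<Sum>j\<in>UNIV. D i j) = 1" for i
  proof -
    have "D i j = (cmod (cdot (u j) (w i)))\<^sup>2" for j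
      unfolding D_def by (subst cnj_cdot[symmetric]) (simp only: complex_mod_cnj)
    then show ?thesis using parseval[OF u, of "w i"] onb_norm[OF w(1), of i] by simp
  qed
  have E: "Re (trace (diag_op u h ** \<rho>)) = (\<Sum>i\<in>UNIV. \<Sum>j\<in>UNIV. D i j * (p i * h j))"
  proof -
    have "Re (trace (diag_op u h ** \<rho>)) = (\<Sum>j\<in>UNIV. \<Sum>i\<in>UNIV. D i j * (p i * h j))"
      by (simp add: trace_diag_op_mult w(2) cdot_diag_op_self D_def sum_distrib_left mult_ac)
    then show ?thesis by (subst sum.swap)
  qed
  have rows: "(\<Sum>i\<in>UNIV. \<Sum>j\<in>UNIV. D i j * f i) = (\<Sum>i\<in>UNIV. f i)" for f
    by (simp add: row flip: sum_distrib_right)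
  have cols: "(\<Sum>i\<in>UNIV. \<Sum>j\<in>UNIV. D i j * f j) = (\<Sum>j\<in>UNIV. f j)" for f
    by (subst sum.swap) (simp add: col flip: sum_distrib_right)
  \<comment> \<open>Both \<open>p\<close> and \<open>q\<close> sum to one and \<open>D\<close> is
    doubly stochastic. Hence \<open>xlogx_ge\<close>, weighted by \<open>D\<close> and summed, shows
    that the relative entropy of \<rho> to the thermal state is nonnegative; expanding
    \<open>ln (q j)\<close> then exposes energy and entropy.\<close>
  have "(\<Sum>i\<in>UNIV. \<Sum>j\<in>UNIV. D i j * (p i - q j)) = 0"
    using rows[of p] cols[of q] by (simp add: algebra_simps sum_subtractf p q1)
  moreover have "(\<Sum>i\<in>UNIV. \<Sum>j\<in>UNIV. D i j * (p i - q j))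
      \<le> (\<Sum>i\<in>UNIV. \<Sum>j\<in>UNIV. D i j * (p i * (ln (p i) - ln (q j))))"
    by (intro sum_mono mult_left_mono xlogx_ge p q) (simp add: D_def)
  moreover have "(\<Sum>i\<in>UNIV. \<Sum>j\<in>UNIV. D i j * (p i * (ln (p i) - ln (q j))))
      = (\<Sum>i\<in>UNIV. \<Sum>j\<in>UNIV. D i j * (p i * ln (p i)) + \<beta> * (D i j * (p i * h j)) + ln ?P * (D i j * p i))"
    by (simp add: q(2) algebra_simps)
  moreover have "\<dots> = - entropy \<rho> + \<beta> * Re (trace (diag_op u h ** \<rho>)) + ln ?P"
    unfolding sum.distrib sum_distrib_left[symmetric] rows E p
    by (simp add: w(2) entropy_diag_op[OF w(1)])
  ultimately have "entropy \<rho> \<le> \<beta> * Re (trace (diag_op u h ** \<rho>)) + ln ?P" by linarith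
  then show ?thesis
    unfolding free_energy_thermal[OF u \<beta>] unfolding free_energy_def using \<beta> by (simp add: field_simps)
qed

text \<open>An eigenvector overlaps some \<open>u k\<close>, which forces its eigenvalue to be
  \<open>\<mu> k\<close>. So the set whose minimum is taken is finite and nonempty.\<close>

lemma min_eigenvalue_diag_op:
  assumes u: "onb u"
  shows "min_eigenvalue (diag_op u \<mu>) = Min (range \<mu>)"
proof -
  have "{c. \<exists>v. v \<noteq> 0 \<and> diag_op u \<mu> *v v = complex_of_real c *s v} = range \<mu>"
  proof safe
    fix c v assume v: "v \<noteq> 0" "diag_op u \<mu> *v v = complex_of_real c *s v"
    then obtain k where "cdot (u k) v \<noteq> 0"
      using onb_expand[OF u, of v] by fastforce
    moreover have "complex_of_real (\<mu> k) * cdot (u k) v = complex_of_real c * cdot (u k) v"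
      using arg_cong[OF v(2), of "cdot (u k)"] by (simp add: cdot_diag_op[OF u] cdot_scale_right)
    ultimately have "c = \<mu> k" by simp
    then show "c \<in> range \<mu>" by simp
  next
    fix k
    have "u k \<noteq> 0" using onb_norm[OF u, of k] by auto
    then show "\<exists>v. v \<noteq> 0 \<and> diag_op u \<mu> *v v = complex_of_real (\<mu> k) *s v"
      using diag_op_eigenvector[OF u, of \<mu> k] by blast
  qed
  then show ?thesis by (simp add: min_eigenvalue_def)
qed

text \<open>A crude bound, uniform over all states. It controls how far mixing in a small multiple
  of a channel can move an output state.\<close>

lemma norm_state_le:
  fixes \<rho> :: "'n::finite op"
  assumes "state \<rho>"
  shows "norm \<rho> \<le> (real CARD('n))\<^sup>2"
proof -
  obtain u p where u: "onb u" "\<rho> = diag_op u p" and p: "\<And>k. 0 \<le> p k" "(\<Sum>k\<in>UNIV. p k) = 1"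
    using state_spectral[OF assms] by blast
  have kb: "norm (ketbra (u k) (u k)) \<le> (real CARD('n))\<^sup>2" for k
  proof -
    have c: "cmod (u k $ i) \<le> 1" for i
      using onb_norm[OF u(1), of k] Finite_Cartesian_Product.norm_nth_le[of "u k" i] by simp
    have "norm (ketbra (u k) (u k)) \<le> (\<Sum>i\<in>UNIV. norm (ketbra (u k) (u k) $ i))"
      unfolding norm_vec_def[of "ketbra (u k) (u k)"] by (intro L2_set_le_sum) simp
    also have "\<dots> \<le> (\<Sum>i\<in>(UNIV::'n set). \<Sum>j\<in>UNIV. cmod (ketbra (u k) (u k) $ i $ j))"
      by (intro sum_mono) (auto simp: norm_vec_def[of "ketbra (u k) (u k) $ _"] intro!: L2_set_le_sum)
    also have "\<dots> \<le> (\<Sum>i\<in>(UNIV::'n set). \<Sum>j\<in>(UNIV::'n set). 1)"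
      by (intro sum_mono) (simp add: ketbra_def norm_mult mult_le_one c)
    finally show ?thesis by (simp add: power2_eq_square)
  qed
  have "norm \<rho> \<le> (\<Sum>k\<in>UNIV. norm (p k *\<^sub>R ketbra (u k) (u k)))"
    unfolding u(2) diag_op_def by (rule norm_sum)
  also have "\<dots> \<le> (\<Sum>k\<in>UNIV. p k * (real CARD('n))\<^sup>2)"
    using p by (intro sum_mono) (simp add: mult_left_mono kb)
  finally show ?thesis by (simp add: p flip: sum_distrib_right)
qed

subsection \<open>Channels and Choi states\<close>

text \<open>Positivity is complete positivity with an ancilla of dimension one.\<close>

lemma channel_state:
  assumes "channel \<E>" "state \<rho>"
  shows "state (\<E> \<rho>)"
proof -
  have "block_psd 1 (\<lambda>_ _. \<rho>)"
    using assms(2) by (simp add: block_psd_def state_def psd_def)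
  then have "block_psd 1 (\<lambda>_ _. \<E> \<rho>)"
    using assms(1) unfolding channel_def completely_positive_def by blast
  then have "cdot v (\<E> \<rho> *v v) \<in> \<real>\<^sub>\<ge>\<^sub>0" for v
    unfolding block_psd_def by (auto dest: spec[of _ "\<lambda>_. v"])
  then show ?thesis
    using assms by (simp add: state_def psd_def channel_def)
qed

lemma vector_space_scale_op: "vector_space (scale_op :: complex \<Rightarrow> 'n::finite op \<Rightarrow> 'n op)"
  by unfold_locales (simp_all add: scale_op_def vec_eq_iff algebra_simps)

lemma channel_id: "channel (\<lambda>X. X)"
  unfolding channel_def completely_positive_def
  by (simp add: vector_space.linear_ident[OF vector_space_scale_op])

lemma id_free_channel: "(\<lambda>X. X) \<in> free_channels \<L>"
  by (simp add: free_channels_def channel_id)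

text \<open>The block \<open>|i\<rangle>\<langle>j| / d\<close> of the maximally entangled state.\<close>

definition choi_block :: "'n::finite \<Rightarrow> 'n \<Rightarrow> 'n op" where
  "choi_block i j = (\<chi> a b. if a = i \<and> b = j then complex_of_real (1 / real CARD('n)) else 0)"

lemma sum_UNIV_prod: "(\<Sum>p\<in>UNIV. f p) = (\<Sum>a\<in>UNIV. \<Sum>b\<in>UNIV. f (a, b))"
  by (simp add: sum.cartesian_product)

lemma choi_nth: "choi \<E> $ p $ q = \<E> (choi_block (snd p) (snd q)) $ fst p $ fst q"
proof -
  have "(\<chi> a a'. ketbra max_ent max_ent $ (a, snd p) $ (a', snd q)) = choi_block (snd p) (snd q)"
    by (simp add: vec_eq_iff ketbra_def max_ent_def choi_block_def flip: of_real_mult)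
  then show ?thesis
    by (simp add: choi_def tensor_id_def)
qed

text \<open>The quadratic form is \<open>1 / d\<close> times the squared modulus of
  \<open>\<Sum>i<k. v i $ h i\<close>, where \<open>d\<close> is the dimension. The map
  \<open>h\<close> links natural-number ancilla labels to the index type of the system.\<close>

lemma block_psd_choi_block:
  fixes h :: "nat \<Rightarrow> 'n::finite"
  shows "block_psd k (\<lambda>i j. choi_block (h i) (h j))"
  unfolding block_psd_def
proof
  fix v :: "nat \<Rightarrow> complex^'n"
  let ?c = "complex_of_real (1 / real CARD('n))"
  let ?z = "\<Sum>i<k. v i $ h i"
  have "cdot x (choi_block i j *v y) = cnj (x $ i) * (?c * y $ j)" for x y :: "complex^'n" and i j
  proof -
    have "(choi_block i j *v y) $ a = (if a = i then ?c * y $ j else 0)" for a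
    proof -
      have "(choi_block i j *v y) $ a = (\<Sum>b\<in>UNIV. if b = j then (if a = i then ?c * y $ j else 0) else 0)"
        by (auto simp: matrix_vector_mult_def choi_block_def if_distrib[of "\<lambda>c. c * _"] cong: if_cong)
      then show ?thesis by simp
    qed
    then have "cdot x (choi_block i j *v y) = (\<Sum>a\<in>UNIV. if a = i then cnj (x $ a) * (?c * y $ j) else 0)"
      unfolding cdot_def by (intro sum.cong) auto
    then show ?thesis by simp
  qed
  then have "(\<Sum>i<k. \<Sum>j<k. cdot (v i) (choi_block (h i) (h j) *v v j))
      = ?c * (?z * cnj ?z)"
    by (simp add: cnj_sum sum_product sum_distrib_left mult_ac)
  also have "\<dots> = complex_of_real (1 / real CARD('n) * (cmod ?z)\<^sup>2)"
    by (simp only: of_real_mult complex_norm_square)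
  finally show "(\<Sum>i<k. \<Sum>j<k. cdot (v i) (choi_block (h i) (h j) *v v j)) \<in> \<real>\<^sub>\<ge>\<^sub>0"
    by (simp del: of_real_mult of_real_divide of_real_power)
qed

lemma state_choi:
  fixes \<E> :: "'n::finite op \<Rightarrow> 'n op"
  assumes \<E>: "channel \<E>"
  shows "state (choi \<E>)"
proof -
  \<comment> \<open>Enumerating the index type lets complete positivity be applied with an ancilla
    of the dimension of the system.\<close>
  obtain h where h: "bij_betw h {..<CARD('n)} (UNIV :: 'n set)"
    using ex_bij_betw_nat_finite[of "UNIV :: 'n set"] by (auto simp: atLeast0LessThan)
  have cp: "block_psd CARD('n) (\<lambda>i j. \<E> (choi_block (h i) (h j)))"
    using \<E> block_psd_choi_block unfolding channel_def completely_positive_def by blast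
  have "cdot v (choi \<E> *v v) \<in> \<real>\<^sub>\<ge>\<^sub>0" for v
  proof -
    \<comment> \<open>Slicing \<open>v\<close> along its second tensor factor gives the ancilla
      components, so that the quadratic form of the Choi operator becomes a block form.\<close>
    define w where "w i = (\<chi> a. v $ (a, i))" for i
    have "cdot v (choi \<E> *v v) = (\<Sum>a\<in>UNIV. \<Sum>i\<in>UNIV. \<Sum>b\<in>UNIV. \<Sum>j\<in>UNIV.
        cnj (w i $ a) * (\<E> (choi_block i j) $ a $ b * w j $ b))"
      by (simp add: cdot_def matrix_vector_mult_def choi_nth w_def sum_distrib_left sum_UNIV_prod)
    also have "\<dots> = (\<Sum>i\<in>UNIV. \<Sum>a\<in>UNIV. \<Sum>b\<in>UNIV. \<Sum>j\<in>UNIV.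
        cnj (w i $ a) * (\<E> (choi_block i j) $ a $ b * w j $ b))"
      by (rule sum.swap)
    also have "\<dots> = (\<Sum>i\<in>UNIV. \<Sum>a\<in>UNIV. \<Sum>j\<in>UNIV. \<Sum>b\<in>UNIV.
        cnj (w i $ a) * (\<E> (choi_block i j) $ a $ b * w j $ b))"
      by (intro sum.cong refl sum.swap)
    also have "\<dots> = (\<Sum>i\<in>UNIV. \<Sum>j\<in>UNIV. \<Sum>a\<in>UNIV. \<Sum>b\<in>UNIV.
        cnj (w i $ a) * (\<E> (choi_block i j) $ a $ b * w j $ b))"
      by (intro sum.cong refl sum.swap)
    also have "\<dots> = (\<Sum>i\<in>UNIV. \<Sum>j\<in>UNIV. cdot (w i) (\<E> (choi_block i j) *v w j))"
      by (simp add: cdot_def matrix_vector_mult_def sum_distrib_left)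
    also have "\<dots> = (\<Sum>i<CARD('n). \<Sum>j<CARD('n). cdot (w (h i)) (\<E> (choi_block (h i) (h j)) *v w (h j)))"
      by (simp flip: sum.reindex_bij_betw[OF h])
    also have "\<dots> \<in> \<real>\<^sub>\<ge>\<^sub>0"
      using cp unfolding block_psd_def by (auto dest: spec[of _ "\<lambda>i. w (h i)"])
    finally show ?thesis .
  qed
  moreover have "trace (choi \<E>) = 1"
  proof -
    have block: "trace (choi_block i i :: 'n op) = complex_of_real (1 / real CARD('n))" for i
      by (simp add: trace_def choi_block_def)
    have "trace (choi \<E>) = (\<Sum>a\<in>UNIV. \<Sum>i\<in>UNIV. \<E> (choi_block i i) $ a $ a)"
      by (simp add: trace_def choi_nth sum_UNIV_prod)
    also have "\<dots> = (\<Sum>i\<in>UNIV. trace (\<E> (choi_block i i)))"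
      unfolding trace_def by (rule sum.swap)
    also have "\<dots> = 1"
      using \<E> by (simp add: channel_def block)
    finally show ?thesis .
  qed
  ultimately show ?thesis by (simp add: state_def psd_def)
qed

lemma free_channels_state_choi: "\<Omega> \<in> free_channels \<L> \<Longrightarrow> state (choi \<Omega>)"
  by (simp add: free_channels_def state_choi)

subsection \<open>Robustness and relative cost\<close>

text \<open>Were the robustness zero, free mixtures with arbitrarily small weight \<open>s\<close>
  would exist. Each sends \<rho> into the free set, at a distance from \<open>\<E> \<rho>\<close>
  that tends to zero with \<open>s\<close>, although \<open>\<E> \<rho>\<close> has a neighbourhood
  without free states.\<close>

lemma robustness_pos:
  fixes \<L> :: "'n::finite op set"
  assumes L: "free_states \<L>" and \<E>: "channel \<E>" "\<E> \<notin> free_channels \<L>"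
  shows "0 < robustness \<L> \<E>"
proof (rule ccontr)
  assume neg: "\<not> 0 < robustness \<L> \<E>"
  obtain \<rho> where \<rho>: "\<rho> \<in> \<L>" "\<E> \<rho> \<notin> \<L>"
    using \<E> by (auto simp: free_channels_def)
  have st: "state \<rho>" using L \<rho> by (auto simp: free_states_def)
  define C where "C = (real CARD('n))\<^sup>2"
  have C: "C > 0" by (simp add: C_def)
  have "open (- \<L>)" using L by (auto simp: free_states_def)
  then obtain e where e: "e > 0" "\<And>X. dist X (\<E> \<rho>) < e \<Longrightarrow> X \<notin> \<L>"
    using \<rho>(2) unfolding open_dist by auto
  \<comment> \<open>The threshold is chosen so that the displacement, at most
    \<open>s * (C + C)\<close>, stays below \<open>e\<close>.\<close>
  have "robustness \<L> \<E> < ereal (e / (2 * C))"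
    using neg e(1) C by (auto simp: not_less intro!: le_less_trans[of "robustness \<L> \<E>" 0])
  then obtain s \<kappa> where s: "s < e / (2 * C)" "0 \<le> s" and \<kappa>: "channel \<kappa>"
    and free: "(\<lambda>X. (1 / (1 + s)) *\<^sub>R (\<E> X + s *\<^sub>R \<kappa> X)) \<in> free_channels \<L>"
    unfolding robustness_def Inf_less_iff by auto
  have mix: "(1 / (1 + s)) *\<^sub>R (\<E> \<rho> + s *\<^sub>R \<kappa> \<rho>) \<in> \<L>"
    using free \<rho>(1) by (auto simp: free_channels_def)
  have "(1 / (1 + s)) *\<^sub>R (\<E> \<rho> + s *\<^sub>R \<kappa> \<rho>) - \<E> \<rho> = (s / (1 + s)) *\<^sub>R (\<kappa> \<rho> - \<E> \<rho>)"
  proof -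
    have "\<E> \<rho> = (1 / (1 + s)) *\<^sub>R ((1 + s) *\<^sub>R \<E> \<rho>)" using s(2) by simp
    then have "(1 / (1 + s)) *\<^sub>R (\<E> \<rho> + s *\<^sub>R \<kappa> \<rho>) - \<E> \<rho>
        = (1 / (1 + s)) *\<^sub>R (\<E> \<rho> + s *\<^sub>R \<kappa> \<rho> - (1 + s) *\<^sub>R \<E> \<rho>)"
      by (simp only: scaleR_diff_right)
    also have "\<E> \<rho> + s *\<^sub>R \<kappa> \<rho> - (1 + s) *\<^sub>R \<E> \<rho> = s *\<^sub>R (\<kappa> \<rho> - \<E> \<rho>)"
      by (simp add: algebra_simps)
    finally show ?thesis by simp
  qed
  then have "dist ((1 / (1 + s)) *\<^sub>R (\<E> \<rho> + s *\<^sub>R \<kappa> \<rho>)) (\<E> \<rho>) = s / (1 + s) * norm (\<kappa> \<rho> - \<E> \<rho>)"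
    using s(2) by (simp add: dist_norm)
  also have "\<dots> \<le> s * (C + C)"
  proof (rule mult_mono)
    show "s / (1 + s) \<le> s" using s(2) by (simp add: field_simps)
    show "norm (\<kappa> \<rho> - \<E> \<rho>) \<le> C + C"
      using norm_state_le[OF channel_state[OF \<kappa> st]] norm_state_le[OF channel_state[OF \<E>(1) st]]
      unfolding C_def by (intro order_trans[OF norm_triangle_ineq4] add_mono)
  qed (use s(2) in auto)
  also have "\<dots> < e" using s(1) C by (simp add: field_simps)
  finally show False using e(2) mix by blast
qed

text \<open>In dimension one an operator is determined by its trace, so a channel fixes every
  operator and is free.\<close>

lemma resourceful_imp_nontrivial:
  fixes \<L> :: "'n::finite op set"
  assumes L: "free_states \<L>" and \<E>: "channel \<E>" "\<E> \<notin> free_channels \<L>"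
  shows "\<exists>i j :: 'n. i \<noteq> j"
proof (rule ccontr)
  assume "\<nexists>i j :: 'n. i \<noteq> j"
  then have one: "i = j" for i j :: 'n by blast
  obtain \<rho> where \<rho>: "\<rho> \<in> \<L>" "\<E> \<rho> \<notin> \<L>"
    using \<E> by (auto simp: free_channels_def)
  have "trace X = X $ i $ j" for X :: "'n op" and i j
  proof -
    have "(UNIV :: 'n set) = {i}" using one by auto
    then have "trace X = (\<Sum>k\<in>{i}. X $ k $ k)" unfolding trace_def by simp
    then show ?thesis using one[of i j] by simp
  qed
  moreover have "trace (\<E> \<rho>) = trace \<rho>"
    using \<E> by (simp add: channel_def)
  ultimately have "\<E> \<rho> = \<rho>" by (simp add: vec_eq_iff)
  then show False using \<rho> by simp
qed

text \<open>Keeping \<open>W\<close> abstract serves both temperatures. The channel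
  \<open>\<Omega>\<^sub>0\<close> makes each supremum nonnegative, hence every quotient nonnegative,
  so the real infimum is bounded below and the single Hamiltonian \<open>H\<close> bounds it from
  above.\<close>

lemma relative_cost_le:
  assumes nonneg: "\<And>H. psd H \<Longrightarrow> 0 \<le> W H \<E>"
    and bdd: "\<And>H. psd H \<Longrightarrow> bdd_above (W H ` free_channels \<L>)"
    and free: "\<Omega>\<^sub>0 \<in> free_channels \<L>" "\<And>H. psd H \<Longrightarrow> 0 \<le> W H \<Omega>\<^sub>0"
    and H: "psd H" "0 < W H \<E>" "\<And>\<Omega>. \<Omega> \<in> free_channels \<L> \<Longrightarrow> W H \<Omega> \<le> s"
  shows "relative_cost W \<L> \<E> \<le> s / W H \<E>"
proof -
  have "relative_cost W \<L> \<E> \<le> (SUP \<Omega>\<in>free_channels \<L>. W H \<Omega>) / W H \<E>"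
    unfolding relative_cost_def
  proof (rule cINF_lower)
    show "bdd_below ((\<lambda>H. (SUP \<Omega>\<in>free_channels \<L>. W H \<Omega>) / W H \<E>) ` {H. psd H \<and> W H \<E> \<noteq> 0})"
    proof (rule bdd_belowI2)
      fix H assume "H \<in> {H. psd H \<and> W H \<E> \<noteq> 0}"
      then have "psd H" by simp
      have "0 \<le> W H \<Omega>\<^sub>0" using \<open>psd H\<close> by (rule free(2))
      also have "\<dots> \<le> (SUP \<Omega>\<in>free_channels \<L>. W H \<Omega>)"
        using free(1) bdd[OF \<open>psd H\<close>] by (rule cSUP_upper)
      finally have "0 \<le> (SUP \<Omega>\<in>free_channels \<L>. W H \<Omega>)" .
      then show "0 \<le> (SUP \<Omega>\<in>free_channels \<L>. W H \<Omega>) / W H \<E>"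
        using nonneg[OF \<open>psd H\<close>] by simp
    qed
  qed (use H in auto)
  also have "\<dots> \<le> s / W H \<E>"
    using free(1) H by (intro divide_right_mono cSUP_least) auto
  finally show ?thesis .
qed

section \<open>Nonnegativity and boundedness of the work costs\<close>

lemma work_cost_nonneg:
  assumes "psd H" "channel \<E>" "0 < \<beta>"
  shows "0 \<le> work_cost \<beta> H \<E>"
proof -
  obtain u h where "onb u" "H = diag_op u h" using psd_spectral[OF assms(1)] by blast
  then show ?thesis
    using free_energy_ge_thermal[OF state_choi[OF assms(2)]] assms(3) by (simp add: work_cost_def)
qed

lemma work_cost_zero_temp_nonneg:
  assumes "psd H" "channel \<E>"
  shows "0 \<le> work_cost_zero_temp H \<E>"
proof -
  obtain u h where u: "onb u" "H = diag_op u h" using psd_spectral[OF assms(1)] by blast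
  have "min_eigenvalue H \<le> Re (trace (H ** choi \<E>))"
    using u by (auto simp: min_eigenvalue_diag_op intro!: state_expectation_ge state_choi assms)
  then show ?thesis by (simp add: work_cost_zero_temp_def)
qed

lemma energy_le_Max:
  assumes "onb u" "channel \<E>"
  shows "Re (trace (diag_op u h ** choi \<E>)) \<le> Max (range h)"
  using assms by (intro state_expectation_le state_choi) auto

lemma bdd_above_work_cost:
  assumes "psd H" "0 < \<beta>"
  shows "bdd_above (work_cost \<beta> H ` free_channels \<L>)"
proof -
  obtain u h where u: "onb u" "H = diag_op u h" using psd_spectral[OF assms(1)] by blast
  have "work_cost \<beta> H \<Omega> \<le> Max (range h) - free_energy \<beta> H (thermal \<beta> H)"
    if "\<Omega> \<in> free_channels \<L>" for \<Omega>
  proof -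
    have "0 \<le> entropy (choi \<Omega>) / \<beta>"
      using that assms(2) by (simp add: entropy_nonneg free_channels_state_choi)
    then show ?thesis
      using energy_le_Max[OF u(1), of \<Omega> h] that u(2)
      by (simp add: work_cost_def free_energy_def[of _ _ "choi _"] free_channels_def)
  qed
  then show ?thesis by (rule bdd_aboveI2)
qed

lemma bdd_above_work_cost_zero_temp:
  assumes "psd H"
  shows "bdd_above (work_cost_zero_temp H ` free_channels \<L>)"
proof -
  obtain u h where u: "onb u" "H = diag_op u h" using psd_spectral[OF assms(1)] by blast
  show ?thesis
    using energy_le_Max[OF u(1), of _ h] u(2)
    by (intro bdd_aboveI2[of _ _ "Max (range h) - min_eigenvalue H"])
      (simp add: work_cost_zero_temp_def free_channels_def)
qed

section \<open>The bounds at positive and at zero temperature\<close>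

lemma shifted_ratio_le:
  fixes a b c :: real
  assumes "0 \<le> c" "a \<le> b" "c < b"
  shows "(a - c) / (b - c) \<le> a / b"
proof -
  \<comment> \<open>All that remains after cross-multiplication; \<open>0 \<le> c < b\<close> makes
    both denominators positive.\<close>
  have "c * a \<le> c * b" using assms by (intro mult_left_mono)
  then show ?thesis using assms by (simp add: divide_simps algebra_simps)
qed

lemma eta_cost_le:
  fixes \<L> :: "'n::finite op set" and Z :: "('n \<times> 'n) op"
  assumes \<E>: "channel \<E>" and nontrivial: "\<exists>i j :: 'n. i \<noteq> j"
    and Z: "psd Z" "\<And>\<Omega>. \<Omega> \<in> free_channels \<L> \<Longrightarrow> Re (trace (Z ** choi \<Omega>)) \<le> 1"
    and R: "Re (trace (Z ** choi \<E>)) = 1 + R"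
    and \<beta>: "0 < \<beta>" and l: "0 < l" "(1 / \<beta>) * entropy (choi \<E>) \<le> l * R"
  shows "eta_cost \<beta> \<L> \<E> \<le>
    (1 + (1 / l) * (1 / \<beta>) * entropy (thermal \<beta> (l *\<^sub>R Z))) /
    (1 + R + (1 / l) * (1 / \<beta>) * (entropy (thermal \<beta> (l *\<^sub>R Z)) - entropy (choi \<E>)))"
proof -
  obtain u z where u: "onb u" "Z = diag_op u z" and z: "\<And>k. 0 \<le> z k"
    using psd_spectral[OF Z(1)] by blast
  define h where "h k = l * z k" for k
  define H where "H = l *\<^sub>R Z"
  have H: "H = diag_op u h" by (simp add: H_def u scaleR_diag_op h_def[abs_def])
  have h0: "0 \<le> h k" for k using z l by (simp add: h_def)
  have psdH: "psd H" by (simp add: H psd_diag_op_iff[OF u(1)] h0)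
  have energy: "Re (trace (H ** X)) = l * Re (trace (Z ** X))" for X
    by (simp add: H u trace_diag_op_mult h_def sum_distrib_left mult_ac)
  define T where "T = thermal \<beta> H"
  \<comment> \<open>Minus the equilibrium free energy of \<open>H\<close>.\<close>
  define g where "g = (1 / \<beta>) * ln (partition_fun \<beta> h)"
  have FT: "free_energy \<beta> H T = - g"
    unfolding T_def H g_def by (simp add: free_energy_thermal[OF u(1) \<beta>])
  have W: "work_cost \<beta> H \<Omega> = l * Re (trace (Z ** choi \<Omega>)) - (1 / \<beta>) * entropy (choi \<Omega>) + g" for \<Omega>
    using FT by (simp add: work_cost_def T_def free_energy_def[of _ _ "choi _"] energy)
  define c where "c = Re (trace (H ** T))"
  have c0: "0 \<le> c"
    unfolding c_def T_def H by (intro state_expectation_ge state_thermal u h0)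
  have g: "g = (1 / \<beta>) * entropy T - c"
    using FT by (simp add: free_energy_def c_def)
  have up: "work_cost \<beta> H \<Omega> \<le> l + g" if "\<Omega> \<in> free_channels \<L>" for \<Omega>
  proof -
    have "0 \<le> (1 / \<beta>) * entropy (choi \<Omega>)"
      using that \<beta> by (simp add: entropy_nonneg free_channels_state_choi)
    moreover have "l * Re (trace (Z ** choi \<Omega>)) \<le> l * 1"
      using that l Z(2) by (intro mult_left_mono) auto
    ultimately show ?thesis by (simp add: W)
  qed
  have pos: "0 < l + g"
  proof -
    obtain k where k: "h k = Min (range h)"
      using Min_in[of "range h"] by (metis finite_imageI finite empty_is_image UNIV_not_empty imageE)
    have "h k \<le> Re (trace (H ** choi (\<lambda>X. X)))"
      unfolding H by (intro state_expectation_ge u state_choi channel_id) (simp add: k)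
    also have "\<dots> \<le> l"
      using Z(2)[OF id_free_channel] l by (simp add: energy)
    finally have hk: "h k \<le> l" .
    \<comment> \<open>A second energy level adds a positive Boltzmann weight, which makes the
      comparison with the partition function strict.\<close>
    obtain k' where k': "k' \<noteq> k"
      using nontrivial by (metis fst_conv)
    have "exp (- \<beta> * l) \<le> exp (- \<beta> * h k)"
      using hk \<beta> by simp
    also have "\<dots> < (\<Sum>j\<in>{k, k'}. exp (- \<beta> * h j))"
      using k' by simp
    also have "\<dots> \<le> partition_fun \<beta> h"
      unfolding partition_fun_def by (intro sum_mono2) auto
    finally have "ln (exp (- \<beta> * l)) < ln (partition_fun \<beta> h)"
      by (subst ln_less_cancel_iff) (auto simp: partition_fun_pos)
    then show ?thesis using \<beta> by (simp add: g_def field_simps)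
  qed
  have WE: "work_cost \<beta> H \<E> = l + l * R - (1 / \<beta>) * entropy (choi \<E>) + g"
    by (simp add: W R algebra_simps)
  \<comment> \<open>The cost is \<open>l + g\<close> plus
    \<open>l * R - (1 / \<beta>) * entropy (choi \<E>)\<close>, and the second summand is
    nonnegative by the assumption on \<open>l\<close>.\<close>
  have WE_pos: "0 < work_cost \<beta> H \<E>"
    using WE pos l(2) by linarith
  \<comment> \<open>Divided by \<open>l\<close>, these are the numerator and denominator of the
    claim. They exceed those of the quotient obtained from \<open>H\<close> by the same thermal
    energy \<open>c\<close>.\<close>
  define a where "a = l + (1 / \<beta>) * entropy T"
  define b where "b = l + l * R + (1 / \<beta>) * (entropy T - entropy (choi \<E>))"
  have num: "a - c = l + g" and den: "b - c = work_cost \<beta> H \<E>"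
    unfolding WE by (simp_all add: a_def b_def g right_diff_distrib)
  have "eta_cost \<beta> \<L> \<E> \<le> (l + g) / work_cost \<beta> H \<E>"
    unfolding eta_cost_def
    by (rule relative_cost_le[where W = "work_cost \<beta>", OF _ _ id_free_channel _ psdH WE_pos up])
      (auto intro: work_cost_nonneg bdd_above_work_cost channel_id \<E> \<beta>)
  also have "\<dots> = (a - c) / (b - c)" by (simp only: num den)
  also have "\<dots> \<le> a / b"
  proof (rule shifted_ratio_le[OF c0])
    show "a \<le> b" using l(2) by (simp add: a_def b_def right_diff_distrib)
    show "c < b" using den WE_pos by simp
  qed
  also have "\<dots> = (a / l) / (b / l)" using l by simp
  also have "a / l = 1 + (1 / l) * (1 / \<beta>) * entropy T"
    using l by (simp add: a_def add_divide_distrib)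
  also have "b / l = 1 + R + (1 / l) * (1 / \<beta>) * (entropy T - entropy (choi \<E>))"
    using l by (simp add: b_def add_divide_distrib)
  finally show ?thesis by (simp only: T_def H_def)
qed

text \<open>Without entropies the quotient is invariant under positive rescaling of the Hamiltonian,
  so the witness itself serves. Its ground energy \<open>c\<close> plays the part of the thermal
  energy and is dropped by \<open>shifted_ratio_le\<close>.\<close>

lemma eta_cost_zero_temp_le:
  fixes \<L> :: "'n::finite op set" and Z :: "('n \<times> 'n) op"
  assumes \<E>: "channel \<E>"
    and Z: "psd Z" "\<And>\<Omega>. \<Omega> \<in> free_channels \<L> \<Longrightarrow> Re (trace (Z ** choi \<Omega>)) \<le> 1"
    and R: "Re (trace (Z ** choi \<E>)) = 1 + R" "0 < R"
  shows "eta_cost_zero_temp \<L> \<E> \<le> 1 / (1 + R)"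
proof -
  obtain u z where u: "onb u" "Z = diag_op u z" and z: "\<And>k. 0 \<le> z k"
    using psd_spectral[OF Z(1)] by blast
  define c where "c = min_eigenvalue Z"
  have c0: "0 \<le> c" using z by (simp add: c_def u min_eigenvalue_diag_op)
  \<comment> \<open>The identity channel is free, so its Choi state has energy at most 1, and the
    ground energy is no larger.\<close>
  have "c \<le> 1"
    using work_cost_zero_temp_nonneg[OF Z(1) channel_id] Z(2)[OF id_free_channel]
    by (simp add: work_cost_zero_temp_def c_def)
  then have c: "c < 1 + R" using R by simp
  have WE: "work_cost_zero_temp Z \<E> = 1 + R - c"
    by (simp add: work_cost_zero_temp_def c_def R)
  have "eta_cost_zero_temp \<L> \<E> \<le> (1 - c) / work_cost_zero_temp Z \<E>"
    unfolding eta_cost_zero_temp_def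
  proof (rule relative_cost_le[where W = work_cost_zero_temp, OF _ _ id_free_channel _ Z(1)])
    show "work_cost_zero_temp Z \<Omega> \<le> 1 - c" if "\<Omega> \<in> free_channels \<L>" for \<Omega>
      using Z(2)[OF that] by (simp add: work_cost_zero_temp_def c_def)
  qed (use WE c in \<open>auto intro: work_cost_zero_temp_nonneg bdd_above_work_cost_zero_temp channel_id \<E>\<close>)
  also have "\<dots> \<le> 1 / (1 + R)"
    unfolding WE using R(2) by (intro shifted_ratio_le c0 c) simp
  finally show ?thesis .
qed

theorem theorem4:
  fixes \<L> :: "'n::finite op set"
    and \<E> :: "'n op \<Rightarrow> 'n op"
    and Z :: "('n \<times> 'n) op"
  assumes "free_states \<L>"
    and "channel \<E>"
    and "\<E> \<notin> free_channels \<L>"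
    and "optimal_witness \<L> \<E> Z"
  shows "let R = real_of_ereal (robustness \<L> \<E>) in
         (\<forall>\<beta> l. 0 < \<beta> \<longrightarrow> 0 < l \<longrightarrow> (1 / \<beta>) * entropy (choi \<E>) / R \<le> l \<longrightarrow>
            eta_cost \<beta> \<L> \<E> \<le>
              (1 + (1 / l) * (1 / \<beta>) * entropy (thermal \<beta> (l *\<^sub>R Z))) /
              (1 + R + (1 / l) * (1 / \<beta>) *
                 (entropy (thermal \<beta> (l *\<^sub>R Z)) - entropy (choi \<E>)))) \<and>
         eta_cost_zero_temp \<L> \<E> \<le> 1 / (1 + R)"
proof -
  \<comment> \<open>The optimality of the witness identifies the extended-real robustness with this
    real number, so it is finite.\<close>
  define R where "R = Re (trace (Z ** choi \<E>)) - 1"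
  have Z: "psd Z" "\<And>\<Omega>. \<Omega> \<in> free_channels \<L> \<Longrightarrow> Re (trace (Z ** choi \<Omega>)) \<le> 1"
    and rob: "robustness \<L> \<E> = ereal R"
    using assms(4) by (auto simp: optimal_witness_def R_def)
  have ZE: "Re (trace (Z ** choi \<E>)) = 1 + R" by (simp add: R_def)
  \<comment> \<open>Positivity lets the hypothesis on \<open>l\<close> be multiplied by
    \<open>R\<close>, and it makes the denominator positive at zero temperature.\<close>
  have R: "0 < R" using robustness_pos[OF assms(1-3)] by (simp add: rob)
  have "eta_cost \<beta> \<L> \<E> \<le>
      (1 + (1 / l) * (1 / \<beta>) * entropy (thermal \<beta> (l *\<^sub>R Z))) /
      (1 + R + (1 / l) * (1 / \<beta>) * (entropy (thermal \<beta> (l *\<^sub>R Z)) - entropy (choi \<E>)))"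
    if "0 < \<beta>" "0 < l" "(1 / \<beta>) * entropy (choi \<E>) / R \<le> l" for \<beta> l
    using eta_cost_le[OF assms(2) resourceful_imp_nontrivial[OF assms(1-3)] Z ZE that(1,2)]
      that(3) R by (simp only: pos_divide_le_eq)
  moreover have "eta_cost_zero_temp \<L> \<E> \<le> 1 / (1 + R)"
    by (rule eta_cost_zero_temp_le[OF assms(2) Z ZE R])
  ultimately show ?thesis unfolding rob real_of_ereal.simps Let_def by (intro conjI allI impI)
qed

end
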